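(* Let $n\ge 6$ be an integer. (a) The polynomial $P^{n,1}(r)$ has a unique root $r_1(n)$ in the interval $(1,2)$. (b) The sequence $n\mapsto r_1(n)$ (for $n\ge 6$) is strictly decreasing. (c) $\lim_{n\to\infty} r_1(n)=1$.
   Context: For an integer $n\ge 2$ let $N=\binom{n}{2}$. The edges $(i,j)$, $1\le i<j\le n$, of $K_n$ are ordered lexicographically $(1,2),(1,3),\dots,(1,n),(2,3),\dots,(n-1,n)$; $(i,j)$ has index $\mathrm{idx}(i,j)=(i-1)n-\binom{i}{2}+(j-i)$. For a binary string $\mathbf{x}=(x_1,\dots,x_n)$, the cut vector $\delta(\mathbf{x})\in\{0,1\}^N$ has entry $1$ at position $\mathrm{idx}(i,j)$ iff $x_i\ne x_j$. For $\delta\in\{0,1\}^N$ and a variable $r$, $W^n(\delta;r)=\sum_{i=1}^N\delta_i r^{N-i}$. For $1\le k\le n$, $C_k=\delta(1^k0^{n-k})$ ($k$ ones followed by $n-k$ zeros). Define $P^{n,1}(r)=W^n(C_1;r)-W^n(C_2;r)$. *)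

theory Defs
  imports "HOL-Analysis.Analysis" "HOL-Computational_Algebra.Polynomial"
begin

(* Natural-number subtraction does not truncate for 1 <= i < j <= n. *)
definition idx :: "nat \<Rightarrow> nat \<Rightarrow> nat \<Rightarrow> nat" where
  "idx n i j = (i - 1) * n - (i choose 2) + (j - i)"

(* Strings and vectors are functions on 1-based positions: a binary string of length n
   is read only at {1..n}, a cut vector only at {1..n choose 2}. *)
definition cut_vector :: "nat \<Rightarrow> (nat \<Rightarrow> nat) \<Rightarrow> nat \<Rightarrow> nat" where
  "cut_vector n x p =
     (if \<exists>i j. 1 \<le> i \<and> i < j \<and> j \<le> n \<and> idx n i j = p \<and> x i \<noteq> x j then 1 else 0)"

definition W :: "nat \<Rightarrow> (nat \<Rightarrow> nat) \<Rightarrow> real poly" where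
  "W n d = (\<Sum>i = 1..n choose 2. monom (real (d i)) ((n choose 2) - i))"

definition C :: "nat \<Rightarrow> nat \<Rightarrow> nat \<Rightarrow> nat" where
  "C n k = cut_vector n (\<lambda>i. if i \<le> k then 1 else 0)"

definition P1 :: "nat \<Rightarrow> real poly" where
  "P1 n = W n (C n 1) - W n (C n 2)"

(* Meaningful only where the root in (1,2) exists and is unique. *)
definition r1 :: "nat \<Rightarrow> real" where
  "r1 n = (THE r. r \<in> {1<..<2} \<and> poly (P1 n) r = 0)"

end

theory Submission
  imports Defs
begin

text \<open>
  With \<open>m = n - 2\<close> and \<open>s = 1 / r\<close> the equation \<open>P1 n = 0\<close> becomes
  \<open>s^(m+1) + \<dots> + s^(2m) = 1\<close>, whose left-hand side increases strictly in \<open>s\<close>; this gives a unique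
  root. Passing from \<open>m\<close> to \<open>m + 1\<close> changes the left-hand side by \<open>s^(m+1) (s^m + s^(m+1) - 1)\<close>.
  At the root for \<open>m\<close> the smallest of the \<open>m\<close> summands gives \<open>m s^(2m) < 1\<close>, so \<open>s^m < 1/2\<close> when
  \<open>m \<ge> 4\<close>, the change is negative, and the root \<open>s\<close> moves up. The largest summand gives
  \<open>m s^m > 1\<close>, that is \<open>r < m^(1/m)\<close>, which tends to 1.
\<close>

definition power_block :: "nat \<Rightarrow> real \<Rightarrow> real" where
  "power_block m s = (\<Sum>j\<in>{m<..2*m}. s ^ j)"

section \<open>Cut vectors and the factorisation of \<open>P1\<close>\<close>

text \<open>The cut edges are exactly those at vertex 1, and they come first in the lexicographic
  order.\<close>

lemma C_1_eq: "n \<ge> 2 \<Longrightarrow> C n 1 p = (if p \<in> {1..n - 1} then 1 else 0)"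
proof -
  assume n: "n \<ge> 2"
  have "(\<exists>i j. 1 \<le> i \<and> i < j \<and> j \<le> n \<and> idx n i j = p \<and>
      (if i \<le> 1 then 1 else 0::nat) \<noteq> (if j \<le> 1 then 1 else 0)) \<longleftrightarrow> p \<in> {1..n - 1}" (is "?L \<longleftrightarrow> ?R")
  proof
    assume ?L
    then obtain i j where ij: "1 \<le> i" "i < j" "j \<le> n" "idx n i j = p" "i \<le> 1"
      by (auto split: if_splits)
    then have "i = 1" by simp
    with ij show ?R by (auto simp: idx_def binomial_eq_0)
  next
    assume ?R
    then show ?L
      by (intro exI[of _ 1] exI[of _ "p + 1"]) (auto simp: idx_def binomial_eq_0)
  qed
  then show ?thesis
    unfolding C_def cut_vector_def by (rule if_cong) (rule refl)+
qed

text \<open>The edge (1,2) at position 1 is not cut. The cut edges (1,j) with j > 2 fill the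
  positions 2 to n - 1, and the cut edges (2,j) continue without a gap from n.\<close>

lemma C_2_eq: "n \<ge> 3 \<Longrightarrow> C n 2 p = (if p \<in> {2..2 * n - 3} then 1 else 0)"
proof -
  assume n: "n \<ge> 3"
  have "(\<exists>i j. 1 \<le> i \<and> i < j \<and> j \<le> n \<and> idx n i j = p \<and>
      (if i \<le> 2 then 1 else 0::nat) \<noteq> (if j \<le> 2 then 1 else 0)) \<longleftrightarrow> p \<in> {2..2 * n - 3}" (is "?L \<longleftrightarrow> ?R")
  proof
    assume ?L
    then obtain i j where ij: "1 \<le> i" "i < j" "j \<le> n" "idx n i j = p" "i \<le> 2" "\<not> j \<le> 2"
      by (auto split: if_splits)
    then have "i = 1 \<or> i = 2" by auto
    with ij show ?R by (auto simp: idx_def binomial_eq_0)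
  next
    assume p: ?R
    show ?L
    proof (cases "p \<le> n - 1")
      case True
      with p n show ?thesis
        by (intro exI[of _ 1] exI[of _ "p + 1"]) (auto simp: idx_def binomial_eq_0)
    next
      case False
      \<comment> \<open>The second endpoint inverts \<open>idx n 2 j = n + j - 3\<close>.\<close>
      with p n show ?thesis
        by (intro exI[of _ 2] exI[of _ "p + 3 - n"]) (auto simp: idx_def)
    qed
  qed
  then show ?thesis
    unfolding C_def cut_vector_def by (rule if_cong) (rule refl)+
qed

lemma poly_W_indicator:
  assumes "\<And>p. d p = (if p \<in> A then 1 else 0)" and "A \<subseteq> {1..n choose 2}"
  shows "poly (W n d) r = (\<Sum>p\<in>A. r ^ ((n choose 2) - p))"
proof -
  have "poly (W n d) r = (\<Sum>p\<in>{1..n choose 2}. if p \<in> A then r ^ ((n choose 2) - p) else 0)"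
    by (auto simp: W_def poly_sum poly_monom assms(1) intro!: sum.cong)
  also have "\<dots> = (\<Sum>p\<in>{1..n choose 2} \<inter> A. r ^ ((n choose 2) - p))"
    by (simp add: sum.inter_restrict)
  finally show ?thesis
    using assms(2) by (simp add: Int_absorb1)
qed

text \<open>Keeps both cut vectors within the coordinates read by \<open>W\<close>, so that the
  exponents in \<open>poly_P1\<close> are not truncated.\<close>

lemma choose_two_ge: "n \<ge> 3 \<Longrightarrow> 2 * n - 3 \<le> n choose 2"
proof (induction n rule: dec_induct)
  case base
  show ?case by (simp add: choose_two)
next
  case (step n)
  have "Suc n choose 2 = n + (n choose 2)" by (simp add: numeral_2_eq_2)
  with step show ?case by simp
qed

text \<open>The positions 2 to n - 1 cancel. What survives is position 1 with sign plus and n to 2 n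
  - 3 with sign minus; dividing by the leading power leaves a block of powers of 1 / r.\<close>

lemma poly_P1:
  assumes n: "n \<ge> 3" and r: "r \<noteq> 0"
  shows "poly (P1 n) r = r ^ ((n choose 2) - 1) * (1 - power_block (n - 2) (1 / r))"
proof -
  let ?N = "n choose 2"
  let ?t = "\<lambda>p. r ^ (?N - p)"
  note N = choose_two_ge[OF n]
  have "poly (W n (C n 1)) r = (\<Sum>p\<in>{1..n - 1}. ?t p)"
    using n N by (intro poly_W_indicator C_1_eq) auto
  also have "{1..n - 1} = insert 1 {2..n - 1}" using n by auto
  also have "(\<Sum>p\<in>insert 1 {2..n - 1}. ?t p) = ?t 1 + (\<Sum>p\<in>{2..n - 1}. ?t p)" by simp
  finally have 1: "poly (W n (C n 1)) r = ?t 1 + (\<Sum>p\<in>{2..n - 1}. ?t p)" .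
  have "poly (W n (C n 2)) r = (\<Sum>p\<in>{2..2 * n - 3}. ?t p)"
    using n N by (intro poly_W_indicator C_2_eq) auto
  also have "{2..2 * n - 3} = {2..n - 1} \<union> {n..2 * n - 3}" using n by auto
  also have "(\<Sum>p\<in>{2..n - 1} \<union> {n..2 * n - 3}. ?t p)
      = (\<Sum>p\<in>{2..n - 1}. ?t p) + (\<Sum>p\<in>{n..2 * n - 3}. ?t p)"
    using n by (intro sum.union_disjoint) auto
  also have "(\<Sum>p\<in>{n..2 * n - 3}. ?t p) = (\<Sum>j\<in>{n - 2<..2 * (n - 2)}. ?t (Suc j))"
    using n by (intro sum.reindex_bij_witness[of _ Suc "\<lambda>p. p - 1"]) auto
  also have "\<dots> = (\<Sum>j\<in>{n - 2<..2 * (n - 2)}. ?t 1 * (1 / r) ^ j)"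
  proof (intro sum.cong refl)
    fix j assume "j \<in> {n - 2<..2 * (n - 2)}"
    then have "?N - 1 = (?N - Suc j) + j" using n N by auto
    then have "?t 1 = ?t (Suc j) * r ^ j" by (metis power_add)
    then show "?t (Suc j) = ?t 1 * (1 / r) ^ j" using r by (simp add: power_divide)
  qed
  also have "\<dots> = ?t 1 * power_block (n - 2) (1 / r)"
    by (simp add: power_block_def sum_distrib_left)
  finally show ?thesis
    using 1 by (simp add: P1_def algebra_simps)
qed

lemma P1_root_iff:
  assumes "n \<ge> 3" and "r \<noteq> 0"
  shows "poly (P1 n) r = 0 \<longleftrightarrow> power_block (n - 2) (1 / r) = 1"
  using assms by (simp add: poly_P1)

section \<open>Monotonicity, recursion and bounds for power blocks\<close>

lemma power_block_strict_mono:
  assumes "m \<ge> 1" "0 \<le> s" "s < t"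
  shows "power_block m s < power_block m t"
  unfolding power_block_def
  using assms by (intro sum_strict_mono) (auto intro: power_strict_mono)

text \<open>The block loses its first exponent m + 1 and gains 2 m + 1 and 2 m + 2. The case m = 0
  is separate because the empty block has no first exponent.\<close>

lemma power_block_Suc:
  "power_block (Suc m) s = power_block m s + s ^ Suc m * (s ^ m * (1 + s) - 1)"
proof (cases "m = 0")
  case True
  have "{Suc 0<..Suc (Suc 0)} = {Suc (Suc 0)}" by auto
  then show ?thesis using True by (simp add: power_block_def power2_eq_square algebra_simps)
next
  case False
  have "{m<..2 * m} = insert (Suc m) {Suc m<..2 * m}" using False by auto
  then have 1: "power_block m s = s ^ Suc m + (\<Sum>j\<in>{Suc m<..2 * m}. s ^ j)"
    by (simp add: power_block_def)
  have "{Suc m<..2 * Suc m} = insert (2 * m + 1) (insert (2 * m + 2) {Suc m<..2 * m})"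
    using False by auto
  then have "power_block (Suc m) s
      = s ^ (2 * m + 1) + s ^ (2 * m + 2) + (\<Sum>j\<in>{Suc m<..2 * m}. s ^ j)"
    by (simp add: power_block_def)
  moreover have "s ^ (2 * m) = s ^ m * s ^ m" by (simp add: mult_2 power_add)
  ultimately show ?thesis using 1 by (simp add: algebra_simps)
qed

text \<open>Each of the m summands is at least \<open>s ^ (2 * m)\<close> and below
  \<open>s ^ m\<close>. With m at least 2 the exponent m + 1 is smaller than 2 m, which makes the
  lower bound strict.\<close>

lemma power_block_bounds:
  assumes "m \<ge> 2" "0 < s" "s < 1"
  shows "real m * s ^ (2 * m) < power_block m s" "power_block m s < real m * s ^ m"
proof -
  have "(\<Sum>j\<in>{m<..2*m}. s ^ (2 * m)) < power_block m s"
    unfolding power_block_def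
  proof (rule sum_strict_mono_ex1)
    show "\<forall>j\<in>{m<..2*m}. s ^ (2 * m) \<le> s ^ j"
      using assms by (auto intro: power_decreasing)
    show "\<exists>j\<in>{m<..2*m}. s ^ (2 * m) < s ^ j"
      using assms by (intro bexI[of _ "Suc m"] power_strict_decreasing) auto
  qed simp
  then show "real m * s ^ (2 * m) < power_block m s" by simp
  have "power_block m s < (\<Sum>j\<in>{m<..2*m}. s ^ m)"
    unfolding power_block_def
    using assms by (intro sum_strict_mono) (auto intro!: power_strict_decreasing)
  then show "power_block m s < real m * s ^ m" by simp
qed

text \<open>Handles the endpoint r = 2, where the geometric sum has a simple closed form.\<close>

lemma power_block_half: "m \<ge> 1 \<Longrightarrow> power_block m (1 / 2) < 1"
proof -
  assume m: "m \<ge> 1"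
  have "power_block k (1 / 2) = (1 / 2) ^ k - (1 / 2) ^ (2 * k)" for k
  proof (induction k)
    case 0
    show ?case by (simp add: power_block_def)
  next
    case (Suc k)
    have "(1 / 2 :: real) ^ (2 * k) = (1 / 2) ^ k * (1 / 2) ^ k" by (simp add: mult_2 power_add)
    with Suc show ?case by (simp add: power_block_Suc algebra_simps)
  qed
  moreover have "(1 / 2 :: real) ^ m \<le> 1" by (simp add: power_le_one)
  moreover have "(1 / 2 :: real) ^ (2 * m) > 0" by simp
  ultimately show ?thesis by (smt (verit))
qed

text \<open>The block is below 1 at s = 1/2 and equals m > 1 at s = 1, so the intermediate value
  theorem gives a root; strict monotonicity makes it unique.\<close>

lemma ex1_power_block_eq_1:
  assumes m: "m \<ge> 2"
  shows "\<exists>!r. r \<in> {1<..<2} \<and> power_block m (1 / r) = 1"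
proof -
  have one: "power_block m 1 > 1" using m by (simp add: power_block_def)
  have half: "power_block m (1 / 2) < 1" using m by (simp add: power_block_half)
  have "continuous_on {1/2..1} (power_block m)"
    unfolding power_block_def by (intro continuous_intros)
  then obtain s where s: "1/2 \<le> s" "s \<le> 1" "power_block m s = 1"
    using IVT'[of "power_block m" "1/2" 1 1] one half by auto
  then have "s \<noteq> 1 / 2" "s \<noteq> 1" using one half less_irrefl by metis+
  with s have s': "1/2 < s" "s < 1" by auto
  show ?thesis
  proof (rule ex1I[of _ "1 / s"])
    show "1 / s \<in> {1<..<2} \<and> power_block m (1 / (1 / s)) = 1"
      using s s' by (auto simp: field_simps)
    fix r assume r: "r \<in> {1<..<2} \<and> power_block m (1 / r) = 1"
    have "1 / r = s"
    proof (rule linorder_cases[of "1 / r" s])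
      assume "1 / r < s"
      with power_block_strict_mono[of m "1 / r" s] r s m show ?thesis by auto
    next
      assume "s < 1 / r"
      with power_block_strict_mono[of m s "1 / r"] r s m show ?thesis by auto
    qed
    then show "r = 1 / s" by auto
  qed
qed

section \<open>The root \<open>r1\<close>: existence, monotonicity and limit\<close>

lemma ex1_P1_root:
  assumes "n \<ge> 4"
  shows "\<exists>!r. r \<in> {1<..<2} \<and> poly (P1 n) r = 0"
proof -
  have "(r \<in> {1<..<2} \<and> poly (P1 n) r = 0) \<longleftrightarrow> (r \<in> {1<..<2} \<and> power_block (n - 2) (1 / r) = 1)" for r
    using assms P1_root_iff[of n r] by auto
  then show ?thesis using ex1_power_block_eq_1[of "n - 2"] assms by simp
qed

text \<open>Unique existence is what gives the definite description \<open>r1\<close> its defining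
  properties.\<close>

lemma r1_root:
  assumes "n \<ge> 4"
  shows "1 < r1 n" "r1 n < 2" "power_block (n - 2) (1 / r1 n) = 1"
proof -
  have *: "r1 n \<in> {1<..<2} \<and> poly (P1 n) (r1 n) = 0"
    unfolding r1_def by (rule theI'[OF ex1_P1_root[OF assms]])
  then show "1 < r1 n" "r1 n < 2" by auto
  then show "power_block (n - 2) (1 / r1 n) = 1"
    using * assms P1_root_iff[of n "r1 n"] by simp
qed

lemma r1_Suc_less:
  assumes n: "n \<ge> 6"
  shows "r1 (Suc n) < r1 n"
proof -
  define m where "m = n - 2"
  define s where "s = 1 / r1 n"
  define t where "t = 1 / r1 (Suc n)"
  have m: "m \<ge> 4" "Suc n - 2 = Suc m" using n by (auto simp: m_def)
  have s: "0 < s" "s < 1" "power_block m s = 1"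
    using r1_root[of n] n by (auto simp: s_def m_def)
  have t: "0 < t" "power_block (Suc m) t = 1"
    using r1_root[of "Suc n"] n m by (auto simp: t_def)
  \<comment> \<open>The bound m >= 4, that is n >= 6, enters here: the factor 4 makes the left side
    the square of \<open>2 * s ^ m\<close>.\<close>
  have "4 * s ^ (2 * m) \<le> real m * s ^ (2 * m)" using m s by (intro mult_right_mono) auto
  also have "\<dots> < 1" using power_block_bounds(1)[of m s] m s by simp
  finally have "(2 * s ^ m)\<^sup>2 < 1\<^sup>2" by (simp add: power_mult_distrib power_even_eq)
  then have "2 * s ^ m < 1" by (rule power_less_imp_less_base) simp
  moreover have "s ^ m * (1 + s) < s ^ m * 2" using s by (intro mult_strict_left_mono) auto
  ultimately have "s ^ m * (1 + s) - 1 < 0" by linarith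
  then have "s ^ Suc m * (s ^ m * (1 + s) - 1) < 0"
    using s by (intro mult_pos_neg) auto
  \<comment> \<open>The left block is now below 1, while the right one equals 1 by the choice of
    \<open>t\<close>.\<close>
  then have "power_block (Suc m) s < power_block (Suc m) t"
    using s t by (simp add: power_block_Suc[of m s])
  then have "s < t"
    using power_block_strict_mono[of "Suc m" t s] t by (cases t s rule: linorder_cases) auto
  then show ?thesis
    using r1_root[of n] r1_root[of "Suc n"] n by (simp add: s_def t_def field_simps)
qed

text \<open>The upper half of the sandwich for the limit; the lower half is
  \<open>1 < r1 n\<close>.\<close>

lemma r1_less_root:
  assumes n: "n \<ge> 4"
  shows "r1 n < root (n - 2) (real (n - 2))"
proof -
  define m where "m = n - 2"
  have m: "m \<ge> 2" using n by (simp add: m_def)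
  have r: "1 < r1 n" "power_block m (1 / r1 n) = 1" using r1_root[OF n] by (auto simp: m_def)
  have "1 < real m * (1 / r1 n) ^ m"
    using power_block_bounds(2)[of m "1 / r1 n"] m r by simp
  then have "r1 n ^ m < real m" using r by (simp add: power_divide field_simps)
  then have "root m (r1 n ^ m) < root m (real m)" using m by (intro real_root_less_mono) auto
  then show ?thesis using m r by (simp add: real_root_power_cancel flip: m_def)
qed

theorem mainTheorem4:
  shows "(\<forall>n\<ge>6. \<exists>!r. r \<in> {1<..<2} \<and> poly (P1 n) r = 0)
    \<and> strict_antimono_on {6..} r1
    \<and> r1 \<longlonglongrightarrow> 1"
proof (intro conjI allI impI)
  fix n :: nat assume "n \<ge> 6"
  then show "\<exists>!r. r \<in> {1<..<2} \<and> poly (P1 n) r = 0" by (intro ex1_P1_root) simp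
next
  show "strict_antimono_on {6..} r1"
  proof (rule monotone_onI)
    fix a b :: nat assume a: "a \<in> {6..}" and "a < b"
    from \<open>a < b\<close> have "Suc a \<le> b" by simp
    then show "r1 b < r1 a"
    proof (induction b rule: dec_induct)
      case base
      show ?case using a by (simp add: r1_Suc_less)
    next
      case (step b)
      then have "r1 (Suc b) < r1 b" using a by (intro r1_Suc_less) simp
      with step.IH show ?case by simp
    qed
  qed
next
  have "(\<lambda>m. root m (real m)) \<longlonglongrightarrow> 1" by (rule LIMSEQ_root)
  then have "(\<lambda>n. root (n - 2) (real (n - 2))) \<longlonglongrightarrow> 1"
    by (rule filterlim_compose) (rule filterlim_minus_const_nat_at_top)
  moreover have "\<forall>\<^sub>F n in sequentially. 1 \<le> r1 n"
    using eventually_ge_at_top[of 4] by eventually_elim (simp add: r1_root less_imp_le)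
  moreover have "\<forall>\<^sub>F n in sequentially. r1 n \<le> root (n - 2) (real (n - 2))"
    using eventually_ge_at_top[of 4] by eventually_elim (rule less_imp_le[OF r1_less_root])
  ultimately show "r1 \<longlonglongrightarrow> 1"
    by (intro tendsto_sandwich[of "\<lambda>_. 1" r1]) auto
qed

end
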